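(* Let $N$ be a positive integer. The maximum number $n_{\max}$ of baskets among which $N$ apples and $N$ pears can be distributed, so that every basket contains the same number of apples and distinct baskets contain distinct numbers of pears, is $$n_{\max} = \max\left\{\, d \in \mathbb{Z}^+ : d \mid N \ \text{and}\ d \le \frac{1+\sqrt{1+8N}}{2} \right\}.$$
   Context: Fix a positive integer $N$. A distribution of $N$ apples and $N$ pears into $n$ baskets ($n$ a positive integer) consists of a non-negative integer $k$ (the number of apples in each basket) with $nk = N$, together with pairwise distinct non-negative integers $p_1, \ldots, p_n$ (the number of pears in each basket) with $p_1 + p_2 + \cdots + p_n = N$. All the fruit must be used; a basket may contain zero pears. The quantity $n_{\max}$ is the largest positive integer $n$ for which such a distribution exists. $\mathbb{Z}^+$ denotes the set of positive integers. *)

theory Defs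
  imports Complex_Main
begin

text \<open>Baskets are indexed by \<open>1, \<dots>, n\<close>; each receives \<open>k\<close> apples and basket \<open>i\<close> receives \<open>p i\<close>
  pears. The values of \<open>p\<close> outside \<open>{1..n}\<close> are irrelevant.\<close>

definition is_distribution :: "nat \<Rightarrow> nat \<Rightarrow> nat \<Rightarrow> (nat \<Rightarrow> nat) \<Rightarrow> bool" where
  "is_distribution N n k p \<longleftrightarrow>
     0 < n \<and> n * k = N \<and> inj_on p {1..n} \<and> (\<Sum>i=1..n. p i) = N"

definition feasible_baskets :: "nat \<Rightarrow> nat set" where
  "feasible_baskets N = {n. \<exists>k p. is_distribution N n k p}"

definition n_max :: "nat \<Rightarrow> nat" where
  "n_max N = Max (feasible_baskets N)"

text \<open>For positive \<open>N\<close>, both sets whose maximum is taken are finite and nonempty, so that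
  \<^const>\<open>Max\<close> really denotes their largest element.\<close>

lemma finite_feasible_baskets:
  assumes "0 < N"
  shows "finite (feasible_baskets N)"
proof (rule finite_subset)
  show "feasible_baskets N \<subseteq> {d. d dvd N}"
    by (auto simp: feasible_baskets_def is_distribution_def)
  show "finite {d. d dvd N}"
    using assms by simp
qed

lemma feasible_baskets_nonempty:
  assumes "0 < N"
  shows "feasible_baskets N \<noteq> {}"
proof -
  have "is_distribution N 1 N (\<lambda>_. N)"
    by (simp add: is_distribution_def)
  then show ?thesis
    unfolding feasible_baskets_def by blast
qed

lemma n_max_greatest:
  assumes "0 < N"
  shows "\<exists>k p. is_distribution N (n_max N) k p"
    and "is_distribution N n k p \<Longrightarrow> n \<le> n_max N"
proof -
  show "\<exists>k p. is_distribution N (n_max N) k p"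
    using Max_in[OF finite_feasible_baskets feasible_baskets_nonempty] assms
    by (auto simp: n_max_def feasible_baskets_def)
  show "n \<le> n_max N" if "is_distribution N n k p"
    unfolding n_max_def
    by (rule Max_ge[OF finite_feasible_baskets[OF assms]])
      (use that in \<open>auto simp: feasible_baskets_def\<close>)
qed

lemma bounded_divisors_finite_nonempty:
  fixes N :: nat
  assumes "0 < N"
  shows "finite {d. 0 < d \<and> d dvd N \<and> real d \<le> (1 + sqrt (1 + 8 * real N)) / 2}"
    and "{d. 0 < d \<and> d dvd N \<and> real d \<le> (1 + sqrt (1 + 8 * real N)) / 2} \<noteq> {}"
proof -
  show "finite {d. 0 < d \<and> d dvd N \<and> real d \<le> (1 + sqrt (1 + 8 * real N)) / 2}"
    by (rule finite_subset[of _ "{d. d dvd N}"]) (use assms in auto)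
  have "1 \<le> sqrt (1 + 8 * real N)"
    by simp
  then have "1 \<in> {d. 0 < d \<and> d dvd N \<and> real d \<le> (1 + sqrt (1 + 8 * real N)) / 2}"
    by simp
  then show "{d. 0 < d \<and> d dvd N \<and> real d \<le> (1 + sqrt (1 + 8 * real N)) / 2} \<noteq> {}"
    by blast
qed

end

theory Submission
  imports Defs
begin

text \<open>The least sum of \<open>n\<close> distinct natural numbers is \<open>0 + 1 + \<dots> + (n - 1) = n (n - 1) / 2\<close>, and
  any larger total is reached by putting the excess on the last summand. So a divisor \<open>n\<close> of \<open>N\<close> is
  feasible iff \<open>n (n - 1) \<le> 2 N\<close>, that is, iff \<open>(2 n - 1)\<^sup>2 \<le> 1 + 8 N\<close>.\<close>

text \<open>Induction adding a new maximum \<open>b\<close>: all of \<open>A\<close> lies below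
  \<open>b\<close>, so the term \<open>card A\<close> gained on the left is at most the
  \<open>b\<close> gained on the right.\<close>

lemma sum_lessThan_card_le_sum:
  fixes A :: "nat set"
  assumes "finite A"
  shows "\<Sum>{..<card A} \<le> \<Sum>A"
  using assms
proof (induction rule: finite_linorder_max_induct)
  case empty
  show ?case by simp
next
  case (insert b A)
  have "A \<subseteq> {..<b}"
    using insert.hyps by auto
  then have "card A \<le> b"
    using card_mono[of "{..<b}" A] by simp
  moreover have "b \<notin> A"
    using insert.hyps by auto
  ultimately show ?case
    using insert by simp
qed

lemma double_sum_lessThan: "2 * \<Sum>{..<n} = n * (n - 1)" for n :: nat
proof (induction n)
  case (Suc n)
  then show ?case by (cases n) auto
qed simp

lemma sum_from_1_pred: "(\<Sum>i=1..n. i - 1) = \<Sum>{..<n}" for n :: nat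
  using sum.atLeast_Suc_atMost_Suc_shift[of "\<lambda>i. i - 1" 0 "n - 1"]
  by (cases n) (simp_all add: atLeast0AtMost lessThan_Suc_atMost)

lemma le_quadratic_root_iff:
  fixes n N :: nat
  assumes "0 < n"
  shows "real n \<le> (1 + sqrt (1 + 8 * real N)) / 2 \<longleftrightarrow> n * (n - 1) \<le> 2 * N"
proof -
  have "real n \<le> (1 + sqrt (1 + 8 * real N)) / 2 \<longleftrightarrow> 2 * real n - 1 \<le> sqrt (1 + 8 * real N)"
    by auto
  \<comment> \<open>Squaring is an equivalence because \<open>0 < n\<close> makes
    \<open>2 * real n - 1\<close> positive.\<close>
  also have "\<dots> \<longleftrightarrow> (2 * real n - 1)\<^sup>2 \<le> 1 + 8 * real N"
    using real_sqrt_le_iff[of "(2 * real n - 1)\<^sup>2" "1 + 8 * real N"] assms by simp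
  also have "\<dots> \<longleftrightarrow> real n * (real n - 1) \<le> 2 * real N"
    by (auto simp: power2_eq_square algebra_simps)
  also have "\<dots> \<longleftrightarrow> real (n * (n - 1)) \<le> real (2 * N)"
    using assms by (simp add: of_nat_diff)
  finally show ?thesis
    by (simp only: of_nat_le_iff)
qed

lemma feasible_baskets_iff:
  "n \<in> feasible_baskets N \<longleftrightarrow> 0 < n \<and> n dvd N \<and> n * (n - 1) \<le> 2 * N"
proof
  assume "n \<in> feasible_baskets N"
  then obtain k p where n: "0 < n" "n * k = N" and inj: "inj_on p {1..n}"
    and sum: "(\<Sum>i=1..n. p i) = N"
    by (auto simp: feasible_baskets_def is_distribution_def)
  \<comment> \<open>Injectivity gives the image exactly \<open>n\<close> elements.\<close>
  have "\<Sum>{..<n} \<le> \<Sum>(p ` {1..n})"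
    using sum_lessThan_card_le_sum[of "p ` {1..n}"] card_image[OF inj] by simp
  also have "\<dots> = N"
    unfolding sum.reindex[OF inj] using sum by simp
  finally show "0 < n \<and> n dvd N \<and> n * (n - 1) \<le> 2 * N"
    using n double_sum_lessThan[of n] by auto
next
  assume n: "0 < n \<and> n dvd N \<and> n * (n - 1) \<le> 2 * N"
  \<comment> \<open>The excess goes to basket \<open>n\<close>, already the fullest, so
    \<open>p\<close> stays strictly increasing.\<close>
  define p where "p i = (i - 1) + (if i = n then N - \<Sum>{..<n} else 0)" for i
  have "strict_mono_on {1..n} p"
    by (rule strict_mono_onI) (auto simp: p_def)
  then have "inj_on p {1..n}"
    by (rule strict_mono_on_imp_inj_on)
  moreover have "(\<Sum>i=1..n. p i) = \<Sum>{..<n} + (N - \<Sum>{..<n})"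
    unfolding p_def sum.distrib sum_from_1_pred using n by simp
  \<comment> \<open>The bound on \<open>n * (n - 1)\<close> yields
    \<open>\<Sum>{..<n} \<le> N\<close>, so the subtraction is not truncated.\<close>
  then have "(\<Sum>i=1..n. p i) = N"
    using n double_sum_lessThan[of n] by simp
  moreover have "n * (N div n) = N"
    using n by simp
  ultimately show "n \<in> feasible_baskets N"
    using n unfolding feasible_baskets_def is_distribution_def by blast
qed

theorem theorem2:
  fixes N :: nat
  assumes "0 < N"
  shows "n_max N = Max {d :: nat. 0 < d \<and> d dvd N \<and> real d \<le> (1 + sqrt (1 + 8 * real N)) / 2}"
proof -
  have "feasible_baskets N
      = {d. 0 < d \<and> d dvd N \<and> real d \<le> (1 + sqrt (1 + 8 * real N)) / 2}"
    using feasible_baskets_iff le_quadratic_root_iff by blast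
  then show ?thesis
    by (simp only: n_max_def)
qed

end
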